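(* Let $(w_1\,\mathrm d\mu,w_2\,\mathrm d\mu)$ be an AT-system on the closed interval $\Delta\subset\mathbb R$, with type II multiple orthogonal polynomials $B_n$, type I linear forms $Q_n$, Hessenberg matrix $\mathbf H$ and associated stochastic matrices $\hat{\mathbf H}$ and $\check{\mathbf H}$. Then, for a Markov chain with transition matrix $\hat{\mathbf H}$ (respectively, $\check{\mathbf H}$), the probability of going from state $n$ to state $m$ after $r$ steps ($n,m,r\in\mathbb N\cup\{0\}$) is $$(\hat{\mathbf H}^r)_{n,m}=\frac{B_m(1)}{B_n(1)}\int_\Delta x^r\,B_n(x)\,Q_m(x)\,\mathrm d\mu(x),$$ respectively $$(\check{\mathbf H}^r)_{n,m}=\frac{Q_m(1)}{Q_n(1)}\int_\Delta x^r\,B_m(x)\,Q_n(x)\,\mathrm d\mu(x).$$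
   Context: All matrices are semi-infinite with rows and columns indexed by $0,1,2,\dots$. Let $\mu$ be a positive Borel measure supported on the closed interval $\Delta\subset\mathbb R$ and $w_1,w_2$ weights on $\Delta$. Put $\xi_{2j}(x)=x^jw_1(x)$ and $\xi_{2j+1}(x)=x^jw_2(x)$ for $j\ge0$. The pair $(w_1\,\mathrm d\mu,w_2\,\mathrm d\mu)$ is an AT-system (algebraic Chebyshev system) if, for each $n$, the functions $\xi_0,\dots,\xi_n$ form a Chebyshev system on $\Delta$ (every nontrivial real linear combination has at most $n$ zeros there). All moments are assumed finite, and all principal minors of the moment matrix $g=\big(\int_\Delta x^i\xi_j(x)\,\mathrm d\mu(x)\big)_{i,j\ge0}$ are assumed nonzero. Type II multiple orthogonal polynomials (on the stepline): $B_n$ is the monic polynomial of degree $n$ with $\int_\Delta B_n\,\xi_j\,\mathrm d\mu=0$ for $0\le j\le n-1$. Type I linear forms: $Q_n$ is the linear combination of $\xi_0,\dots,\xi_n$ (so $Q_n=A^1_nw_1+A^2_nw_2$ with polynomials $A_n^1,A_n^2$) with $\int_\Delta x^jQ_n(x)\,\mathrm d\mu(x)=0$ for $0\le j\le n-1$, normalized so that $\int_\Delta B_m Q_k\,\mathrm d\mu=\delta_{m,k}$ for all $m,k\ge0$. Hessenberg matrix: $\mathbf H=(\mathbf H_{n,m})$ is the tetradiagonal matrix determined by $x\,B_n(x)=\sum_m\mathbf H_{n,m}B_m(x)$, i.e. $\mathbf H_{n,n+1}=1$, $\mathbf H_{n,n}=c_n$, $\mathbf H_{n,n-1}=b_n$,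 $\mathbf H_{n,n-2}=a_n$, all other entries zero. It also satisfies $x\,Q_m(x)=\sum_nQ_n(x)\mathbf H_{n,m}$. Standing assumptions: $\mathbf H$ is bounded, entrywise nonnegative, $a_n>0$, normalized by rescaling the variable to have operator norm one, and $B_n(1)>0$, $Q_n(1)>0$ for all $n\ge0$. Stochastic matrices: with $\sigma_{II}=\operatorname{diag}(B_0(1),B_1(1),B_2(1),\dots)$ (here $B_0(1)=1$) and $\sigma_I=\operatorname{diag}(Q_0(1),Q_1(1),Q_2(1),\dots)$, $$\hat{\mathbf H}=\sigma_{II}^{-1}\,\mathbf H\,\sigma_{II},\qquad \check{\mathbf H}=\sigma_I^{-1}\,\mathbf H^{\top}\sigma_I .$$
   Formalization: Operator norm one is impossible for the monic H (entries 1 and a_n>0 share a column); it is read as: H arises from a monic recurrence matrix K by dividing the variable by the ℓ² operator norm of K, so that a diagonal conjugate of H has norm one. *)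

theory Defs
  imports
    "HOL-Probability.Probability"
    "HOL-Computational_Algebra.Polynomial"
    "Jordan_Normal_Form.Determinant"
begin

subsection \<open>Semi-infinite matrices\<close>

type_synonym inf_mat = "nat \<Rightarrow> nat \<Rightarrow> real"

definition inf_mult :: "inf_mat \<Rightarrow> inf_mat \<Rightarrow> inf_mat" where
  "inf_mult A C n m = (\<Sum>k. A n k * C k m)"

definition inf_diag :: "(nat \<Rightarrow> real) \<Rightarrow> inf_mat" where
  "inf_diag d n m = (if n = m then d n else 0)"

definition inf_transpose :: "inf_mat \<Rightarrow> inf_mat" where
  "inf_transpose A n m = A m n"

fun inf_power :: "inf_mat \<Rightarrow> nat \<Rightarrow> inf_mat" where
  "inf_power A 0 = inf_diag (\<lambda>_. 1)"
| "inf_power A (Suc r) = inf_mult A (inf_power A r)"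

definition stochastic_matrix :: "inf_mat \<Rightarrow> bool" where
  "stochastic_matrix P \<longleftrightarrow> (\<forall>n m. 0 \<le> P n m) \<and> (\<forall>n. P n sums 1)"

subsection \<open>Matrices as operators on square-summable sequences\<close>

definition l2_seq :: "(nat \<Rightarrow> real) \<Rightarrow> bool" where
  "l2_seq v \<longleftrightarrow> summable (\<lambda>n. (v n)\<^sup>2)"

definition l2_norm :: "(nat \<Rightarrow> real) \<Rightarrow> real" where
  "l2_norm v = sqrt (\<Sum>n. (v n)\<^sup>2)"

definition inf_mat_vec :: "inf_mat \<Rightarrow> (nat \<Rightarrow> real) \<Rightarrow> nat \<Rightarrow> real" where
  "inf_mat_vec A v n = (\<Sum>m. A n m * v m)"

definition l2_bounded :: "inf_mat \<Rightarrow> bool" where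
  "l2_bounded A \<longleftrightarrow>
     (\<exists>C. \<forall>v. l2_seq v \<longrightarrow>
        (\<forall>n. summable (\<lambda>m. A n m * v m)) \<and>
        l2_seq (inf_mat_vec A v) \<and>
        l2_norm (inf_mat_vec A v) \<le> C * l2_norm v)"

definition l2_op_norm :: "inf_mat \<Rightarrow> real" where
  "l2_op_norm A = (SUP v \<in> {v. l2_seq v \<and> l2_norm v \<le> 1}. l2_norm (inf_mat_vec A v))"

text \<open>
  If the monic polynomials \<open>B n\<close> satisfy \<open>x * B n x = (\<Sum>m. H n m * B m x)\<close>, then the
  polynomials \<open>s ^ n * B n (y / s)\<close>, monic in the new variable \<open>y = s * x\<close>, satisfy the same
  recurrence in \<open>y\<close> with the matrix \<open>rescale_variable s H\<close>.
\<close>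

definition rescale_variable :: "real \<Rightarrow> inf_mat \<Rightarrow> inf_mat" where
  "rescale_variable s H n m = s powi (int n + 1 - int m) * H n m"

text \<open>
  \<open>H\<close> is obtained from a bounded recurrence matrix \<open>K\<close> of norm \<open>s\<close> by dividing the variable by
  \<open>s\<close>. Equivalently \<open>K / s\<close>, which is conjugate to \<open>H\<close> by the diagonal matrix with entries
  \<open>s ^ n\<close>, has norm one. The norm of \<open>H\<close> itself cannot be used here: its superdiagonal is kept
  equal to one by taking monic polynomials, so column \<open>n + 1\<close> contains the entry 1 and the
  entry \<open>H (n + 3) (n + 1) > 0\<close>, which forces the norm of \<open>H\<close> to exceed one.
\<close>

definition norm_one_normalized :: "inf_mat \<Rightarrow> bool" where
  "norm_one_normalized H \<longleftrightarrow>
     (\<exists>s > 0. l2_bounded (rescale_variable s H) \<and> l2_op_norm (rescale_variable s H) = s)"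

subsection \<open>AT-systems\<close>

definition weight_on :: "real set \<Rightarrow> (real \<Rightarrow> real) \<Rightarrow> bool" where
  "weight_on \<Delta> w \<longleftrightarrow> w \<in> borel_measurable (restrict_space borel \<Delta>) \<and> (\<forall>x\<in>\<Delta>. 0 \<le> w x)"

definition xi :: "(real \<Rightarrow> real) \<Rightarrow> (real \<Rightarrow> real) \<Rightarrow> nat \<Rightarrow> real \<Rightarrow> real" where
  "xi w1 w2 k x = x ^ (k div 2) * (if even k then w1 x else w2 x)"

definition chebyshev_system_on :: "real set \<Rightarrow> nat \<Rightarrow> (nat \<Rightarrow> real \<Rightarrow> real) \<Rightarrow> bool" where
  "chebyshev_system_on \<Delta> n f \<longleftrightarrow>
     (\<forall>c :: nat \<Rightarrow> real. (\<exists>j\<le>n. c j \<noteq> 0) \<longrightarrow>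
        finite {x\<in>\<Delta>. (\<Sum>j\<le>n. c j * f j x) = 0} \<and>
        card {x\<in>\<Delta>. (\<Sum>j\<le>n. c j * f j x) = 0} \<le> n)"

definition AT_system :: "real measure \<Rightarrow> real set \<Rightarrow> (real \<Rightarrow> real) \<Rightarrow> (real \<Rightarrow> real) \<Rightarrow> bool" where
  "AT_system \<mu> \<Delta> w1 w2 \<longleftrightarrow>
     is_interval \<Delta> \<and> closed \<Delta> \<and>
     sets \<mu> = sets borel \<and> emeasure \<mu> (- \<Delta>) = 0 \<and>
     weight_on \<Delta> w1 \<and> weight_on \<Delta> w2 \<and>
     (\<forall>n. chebyshev_system_on \<Delta> n (xi w1 w2))"

definition finite_moments :: "real measure \<Rightarrow> real set \<Rightarrow> (real \<Rightarrow> real) \<Rightarrow> (real \<Rightarrow> real) \<Rightarrow> bool" where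
  "finite_moments \<mu> \<Delta> w1 w2 \<longleftrightarrow> (\<forall>i j. set_integrable \<mu> \<Delta> (\<lambda>x. x ^ i * xi w1 w2 j x))"

definition moment_matrix :: "real measure \<Rightarrow> real set \<Rightarrow> (real \<Rightarrow> real) \<Rightarrow> (real \<Rightarrow> real) \<Rightarrow> inf_mat" where
  "moment_matrix \<mu> \<Delta> w1 w2 i j = (LINT x:\<Delta>|\<mu>. x ^ i * xi w1 w2 j x)"

definition leading_principal_minor :: "inf_mat \<Rightarrow> nat \<Rightarrow> real" where
  "leading_principal_minor g n = Determinant.det (Matrix.mat n n (\<lambda>(i, j). g i j))"

subsection \<open>Multiple orthogonal polynomials on the stepline\<close>

definition type_II_polys ::
  "real measure \<Rightarrow> real set \<Rightarrow> (real \<Rightarrow> real) \<Rightarrow> (real \<Rightarrow> real) \<Rightarrow> (nat \<Rightarrow> real poly) \<Rightarrow> bool" where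
  "type_II_polys \<mu> \<Delta> w1 w2 B \<longleftrightarrow>
     (\<forall>n. degree (B n) = n \<and> lead_coeff (B n) = 1 \<and>
        (\<forall>j<n. (LINT x:\<Delta>|\<mu>. poly (B n) x * xi w1 w2 j x) = 0))"

text \<open>
  A linear form is a combination of \<open>xi w1 w2 0, \<dots>, xi w1 w2 n\<close> as a function on the whole line,
  not only on \<open>\<Delta>\<close>, so that its value at 1 is determined by its coefficients.
\<close>

definition type_I_forms ::
  "real measure \<Rightarrow> real set \<Rightarrow> (real \<Rightarrow> real) \<Rightarrow> (real \<Rightarrow> real) \<Rightarrow> (nat \<Rightarrow> real poly) \<Rightarrow>
   (nat \<Rightarrow> real \<Rightarrow> real) \<Rightarrow> bool" where
  "type_I_forms \<mu> \<Delta> w1 w2 B Q \<longleftrightarrow>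
     (\<forall>n. (\<exists>q :: nat \<Rightarrow> real. \<forall>x. Q n x = (\<Sum>j\<le>n. q j * xi w1 w2 j x)) \<and>
        (\<forall>j<n. (LINT x:\<Delta>|\<mu>. x ^ j * Q n x) = 0)) \<and>
     (\<forall>m k. (LINT x:\<Delta>|\<mu>. poly (B m) x * Q k x) = (if m = k then 1 else 0))"

definition hessenberg_matrix :: "(nat \<Rightarrow> real poly) \<Rightarrow> inf_mat \<Rightarrow> bool" where
  "hessenberg_matrix B H \<longleftrightarrow>
     (\<forall>n m. H n m \<noteq> 0 \<longrightarrow> m \<le> n + 1 \<and> n \<le> m + 2) \<and>
     (\<forall>n. H n (n + 1) = 1) \<and>
     (\<forall>n x. x * poly (B n) x = (\<Sum>m\<le>n + 1. H n m * poly (B m) x))"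

definition sigma_II :: "(nat \<Rightarrow> real poly) \<Rightarrow> nat \<Rightarrow> real" where
  "sigma_II B n = poly (B n) 1"

definition sigma_I :: "(nat \<Rightarrow> real \<Rightarrow> real) \<Rightarrow> nat \<Rightarrow> real" where
  "sigma_I Q n = Q n 1"

definition H_hat :: "(nat \<Rightarrow> real poly) \<Rightarrow> inf_mat \<Rightarrow> inf_mat" where
  "H_hat B H =
     inf_mult (inf_mult (inf_diag (\<lambda>n. inverse (sigma_II B n))) H) (inf_diag (sigma_II B))"

definition H_check :: "(nat \<Rightarrow> real \<Rightarrow> real) \<Rightarrow> inf_mat \<Rightarrow> inf_mat" where
  "H_check Q H =
     inf_mult (inf_mult (inf_diag (\<lambda>n. inverse (sigma_I Q n))) (inf_transpose H))
       (inf_diag (sigma_I Q))"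

subsection \<open>Markov chains on the natural numbers\<close>

definition markov_chain :: "'a measure \<Rightarrow> (nat \<Rightarrow> 'a \<Rightarrow> nat) \<Rightarrow> inf_mat \<Rightarrow> bool" where
  "markov_chain M X P \<longleftrightarrow>
     prob_space M \<and> (\<forall>k. X k \<in> measurable M (count_space UNIV)) \<and> stochastic_matrix P \<and>
     (\<forall>k s j. \<P>(\<omega> in M. \<forall>i\<le>k. X i \<omega> = s i) > 0 \<longrightarrow>
        \<P>(\<omega> in M. X (Suc k) \<omega> = j \<bar> \<forall>i\<le>k. X i \<omega> = s i) = P (s k) j)"

definition transition_probability ::
  "'a measure \<Rightarrow> (nat \<Rightarrow> 'a \<Rightarrow> nat) \<Rightarrow> nat \<Rightarrow> nat \<Rightarrow> nat \<Rightarrow> nat \<Rightarrow> real" where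
  "transition_probability M X k r n m = \<P>(\<omega> in M. X (k + r) \<omega> = m \<bar> X k \<omega> = n)"

end

theory Submission
  imports Defs
begin

text \<open>
  Write \<open>J r n m = \<integral> x ^ r * B\<^sub>n * Q\<^sub>m d\<mu>\<close>. Biorthogonality says that \<open>J 0\<close> is the identity
  matrix, and integrating \<open>x * B\<^sub>n = (\<Sum>k. H n k * B\<^sub>k)\<close> against \<open>x ^ r * Q\<^sub>m\<close> says that
  \<open>J (r + 1) = H J r\<close>. So \<open>J r\<close> is the \<open>r\<close>-th power of \<open>H\<close>, and it also satisfies
  \<open>J (r + 1) = J r H\<close>. Conjugation by \<open>\<sigma>\<^sub>I\<^sub>I\<close> is compatible with the first identity and gives the
  powers of \<open>\<sigma>\<^sub>I\<^sub>I\<^sup>-\<^sup>1 H \<sigma>\<^sub>I\<^sub>I\<close>; transposition followed by conjugation with \<open>\<sigma>\<^sub>I\<close> turns the second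
  identity into the recursion for the powers of \<open>\<sigma>\<^sub>I\<^sup>-\<^sup>1 H\<^sup>T \<sigma>\<^sub>I\<close>. Since \<open>H\<close> is banded, every
  matrix product involved is a finite sum (\<open>moment_form_Suc_left\<close>, \<open>moment_form_Suc_right\<close>).
  The second identity is the integrated form of \<open>x * Q\<^sub>m = (\<Sum>k. Q\<^sub>k * H k m)\<close>; here it follows from
  the first by induction on \<open>r\<close>, because the powers of \<open>H\<close> commute with \<open>H\<close>.

  That powers of the transition matrix are the multi-step transition probabilities holds for every
  Markov chain on the natural numbers (\<open>transition_probability_eq_inf_power\<close>). The one-step law
  is given conditionally on the whole past, so the induction on the number of steps conditions on
  the whole past as well; the past before time \<open>k\<close> is then summed out one coordinate at a time.
\<close>

section \<open>Products of banded semi-infinite matrices\<close>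

lemma inf_mult_finite_row:
  assumes "\<And>k. k > N \<Longrightarrow> A n k = 0"
  shows "inf_mult A C n m = (\<Sum>k\<le>N. A n k * C k m)"
  unfolding inf_mult_def by (rule suminf_finite) (auto simp: assms)

lemma inf_mult_diag_left: "inf_mult (inf_diag d) A n m = d n * A n m"
proof -
  have "inf_mult (inf_diag d) A n m = (\<Sum>k\<in>{n}. inf_diag d n k * A k m)"
    unfolding inf_mult_def by (rule suminf_finite) (auto simp: inf_diag_def)
  then show ?thesis by (simp add: inf_diag_def)
qed

lemma inf_mult_diag_right: "inf_mult A (inf_diag d) n m = A n m * d m"
proof -
  have "inf_mult A (inf_diag d) n m = (\<Sum>k\<in>{m}. A n k * inf_diag d k m)"
    unfolding inf_mult_def by (rule suminf_finite) (auto simp: inf_diag_def)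
  then show ?thesis by (simp add: inf_diag_def)
qed

text \<open>
  A sequence of matrices that obeys the same recursion as the powers of \<open>A\<close> consists, after
  conjugation by a diagonal matrix, of the powers of the conjugate of \<open>A\<close>. The bound \<open>N\<close> on the
  support of the rows keeps the recursion finite.
\<close>

lemma inf_power_diag_conjugate:
  assumes d: "\<And>n. d n \<noteq> (0::real)"
    and supp: "\<And>n k. k > N n \<Longrightarrow> A n k = 0"
    and J0: "\<And>n m. J 0 n m = (if n = m then 1 else 0)"
    and J_Suc: "\<And>r n m. J (Suc r) n m = (\<Sum>k\<le>N n. A n k * J r k m)"
  shows "inf_power (inf_mult (inf_mult (inf_diag (\<lambda>n. inverse (d n))) A) (inf_diag d)) r n m
           = d m / d n * J r n m"
    (is "inf_power ?P r n m = _")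
proof (induction r arbitrary: n)
  case 0
  then show ?case by (simp add: inf_diag_def J0 d)
next
  case (Suc r)
  have P: "?P n k = A n k * d k / d n" for k
    by (simp add: inf_mult_diag_left inf_mult_diag_right field_simps)
  have "inf_power ?P (Suc r) n m = (\<Sum>k\<le>N n. ?P n k * inf_power ?P r k m)"
    unfolding inf_power.simps by (rule inf_mult_finite_row) (simp add: P supp)
  also have "\<dots> = (\<Sum>k\<le>N n. d m / d n * (A n k * J r k m))"
    by (intro sum.cong refl) (simp add: P Suc.IH d)
  also have "\<dots> = d m / d n * J (Suc r) n m"
    by (simp add: J_Suc sum_distrib_left)
  finally show ?case .
qed

section \<open>Moments of the biorthogonal system\<close>

definition moment_form ::
  "real measure \<Rightarrow> real set \<Rightarrow> (nat \<Rightarrow> real poly) \<Rightarrow> (nat \<Rightarrow> real \<Rightarrow> real) \<Rightarrow>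
   nat \<Rightarrow> nat \<Rightarrow> nat \<Rightarrow> real" where
  "moment_form \<mu> \<Delta> B Q r n m = (LINT x:\<Delta>|\<mu>. x ^ r * poly (B n) x * Q m x)"

lemma set_integrable_poly_mult_type_I:
  assumes moments: "finite_moments \<mu> \<Delta> w1 w2" and Q: "type_I_forms \<mu> \<Delta> w1 w2 B Q"
  shows "set_integrable \<mu> \<Delta> (\<lambda>x. poly p x * Q m x)"
proof -
  obtain q where q: "\<And>x. Q m x = (\<Sum>j\<le>m. q j * xi w1 w2 j x)"
    using Q unfolding type_I_forms_def by blast
  have eq: "poly p x * Q m x
      = (\<Sum>i\<le>degree p. \<Sum>j\<le>m. coeff p i * q j * (x ^ i * xi w1 w2 j x))" for x
    by (simp add: poly_altdef q sum_product mult_ac)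
  have "integrable \<mu> (\<lambda>x. indicator \<Delta> x *\<^sub>R (x ^ i * xi w1 w2 j x))" for i j
    using moments by (simp add: finite_moments_def set_integrable_def)
  then have "integrable \<mu> (\<lambda>x. \<Sum>i\<le>degree p. \<Sum>j\<le>m.
      coeff p i * q j * (indicator \<Delta> x *\<^sub>R (x ^ i * xi w1 w2 j x)))"
    by (intro Bochner_Integration.integrable_sum integrable_mult_right)
  then show ?thesis
    unfolding set_integrable_def eq by (simp add: sum_distrib_left mult_ac)
qed

lemma moment_form_0:
  assumes "type_I_forms \<mu> \<Delta> w1 w2 B Q"
  shows "moment_form \<mu> \<Delta> B Q 0 n m = (if n = m then 1 else 0)"
  using assms by (simp add: moment_form_def type_I_forms_def)

lemma moment_form_Suc_left:
  assumes moments: "finite_moments \<mu> \<Delta> w1 w2" and Q: "type_I_forms \<mu> \<Delta> w1 w2 B Q"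
    and H: "hessenberg_matrix B H"
  shows "moment_form \<mu> \<Delta> B Q (Suc r) n m
           = (\<Sum>k\<le>n + 1. H n k * moment_form \<mu> \<Delta> B Q r k m)"
proof -
  have int: "integrable \<mu> (\<lambda>x. indicator \<Delta> x *\<^sub>R (x ^ r * poly (B k) x * Q m x))" for k
    using set_integrable_poly_mult_type_I[OF moments Q, of "monom 1 r * B k" m]
    by (simp add: set_integrable_def poly_monom)
  have rec: "x * poly (B n) x = (\<Sum>k\<le>n + 1. H n k * poly (B k) x)" for x
    using H unfolding hessenberg_matrix_def by blast
  have "x ^ Suc r * poly (B n) x * Q m x
      = (\<Sum>k\<le>n + 1. H n k * (x ^ r * poly (B k) x * Q m x))" for x
  proof -
    have "x ^ Suc r * poly (B n) x * Q m x = x ^ r * (x * poly (B n) x) * Q m x"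
      by simp
    also have "\<dots> = (\<Sum>k\<le>n + 1. H n k * (x ^ r * poly (B k) x * Q m x))"
      unfolding rec sum_distrib_left sum_distrib_right by (simp only: mult_ac)
    finally show ?thesis .
  qed
  then have "moment_form \<mu> \<Delta> B Q (Suc r) n m
      = (\<integral>x. (\<Sum>k\<le>n + 1. H n k * (indicator \<Delta> x *\<^sub>R (x ^ r * poly (B k) x * Q m x))) \<partial>\<mu>)"
    unfolding moment_form_def set_lebesgue_integral_def
    by (simp only: scaleR_sum_right) (simp only: real_scaleR_def mult_ac)
  also have "\<dots> = (\<Sum>k\<le>n + 1. H n k * moment_form \<mu> \<Delta> B Q r k m)"
    unfolding moment_form_def set_lebesgue_integral_def
    using int by (subst Bochner_Integration.integral_sum) (auto intro: integrable_mult_right)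
  finally show ?thesis .
qed

text \<open>
  The matrices \<open>moment_form \<mu> \<Delta> B Q r\<close> are the powers of \<open>H\<close>, so they commute with \<open>H\<close>. The upper
  limit \<open>m + 2\<close> reflects the two subdiagonals of \<open>H\<close>.
\<close>

lemma moment_form_Suc_right:
  assumes moments: "finite_moments \<mu> \<Delta> w1 w2" and Q: "type_I_forms \<mu> \<Delta> w1 w2 B Q"
    and H: "hessenberg_matrix B H"
  shows "moment_form \<mu> \<Delta> B Q (Suc r) n m
           = (\<Sum>k\<le>m + 2. moment_form \<mu> \<Delta> B Q r n k * H k m)"
proof (induction r arbitrary: n)
  case 0
  have band: "H n m = 0" if "m > n + 1 \<or> n > m + 2"
    using H that unfolding hessenberg_matrix_def by (meson not_less)
  have "moment_form \<mu> \<Delta> B Q (Suc 0) n m = (\<Sum>k\<le>n + 1. if k = m then H n k else 0)"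
    unfolding moment_form_Suc_left[OF assms] moment_form_0[OF Q]
    by (intro sum.cong) auto
  also have "\<dots> = H n m"
    using band by (subst sum.delta) auto
  also have "H n m = (\<Sum>k\<le>m + 2. if k = n then H k m else 0)"
    using band by (subst sum.delta) auto
  also have "\<dots> = (\<Sum>k\<le>m + 2. moment_form \<mu> \<Delta> B Q 0 n k * H k m)"
    unfolding moment_form_0[OF Q] by (intro sum.cong) auto
  finally show ?case .
next
  case (Suc r)
  let ?J = "moment_form \<mu> \<Delta> B Q"
  have "?J (Suc (Suc r)) n m = (\<Sum>l\<le>n + 1. H n l * ?J (Suc r) l m)"
    by (rule moment_form_Suc_left[OF assms])
  also have "\<dots> = (\<Sum>l\<le>n + 1. \<Sum>k\<le>m + 2. H n l * ?J r l k * H k m)"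
    unfolding Suc.IH by (simp only: sum_distrib_left mult.assoc)
  also have "\<dots> = (\<Sum>k\<le>m + 2. \<Sum>l\<le>n + 1. H n l * ?J r l k * H k m)"
    by (rule sum.swap)
  also have "\<dots> = (\<Sum>k\<le>m + 2. ?J (Suc r) n k * H k m)"
    unfolding moment_form_Suc_left[OF assms] by (simp only: sum_distrib_right)
  finally show ?case .
qed

section \<open>Multi-step transition probabilities\<close>

lemma (in prob_space) prob_sums_over_values:
  fixes X :: "'a \<Rightarrow> nat"
  assumes [measurable]: "X \<in> measurable M (count_space UNIV)" "Measurable.pred M A"
  shows "(\<lambda>j. \<P>(\<omega> in M. A \<omega> \<and> X \<omega> = j)) sums \<P>(\<omega> in M. A \<omega>)"
proof -
  have "(\<lambda>j. \<P>(\<omega> in M. A \<omega> \<and> X \<omega> = j)) sums prob (\<Union>j. {\<omega>\<in>space M. A \<omega> \<and> X \<omega> = j})"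
    by (rule finite_measure_UNION) (auto simp: disjoint_family_on_def)
  also have "(\<Union>j. {\<omega>\<in>space M. A \<omega> \<and> X \<omega> = j}) = {\<omega>\<in>space M. A \<omega>}"
    by auto
  finally show ?thesis .
qed

text \<open>
  Conditioning on the next state \<open>j\<close> extends the prescribed past by one coordinate, which is why
  the past has to be arbitrary in the induction. Stated as a product rather than as a quotient,
  the identity holds also for a past of probability zero.
\<close>

lemma prob_given_past_eq_inf_power:
  assumes chain: "markov_chain M X P"
  shows "\<P>(\<omega> in M. (\<forall>i\<le>k. X i \<omega> = s i) \<and> X (k + r) \<omega> = m)
           = \<P>(\<omega> in M. \<forall>i\<le>k. X i \<omega> = s i) * inf_power P r (s k) m"
proof (induction r arbitrary: k s)
  interpret prob_space M using chain by (simp add: markov_chain_def)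
  case 0
  have "{\<omega>\<in>space M. (\<forall>i\<le>k. X i \<omega> = s i) \<and> X k \<omega> = m}
      = (if s k = m then {\<omega>\<in>space M. \<forall>i\<le>k. X i \<omega> = s i} else {})"
    by auto
  then show ?case
    by (simp add: inf_diag_def)
next
  interpret prob_space M using chain by (simp add: markov_chain_def)
  case (Suc r)
  have [measurable]: "X i \<in> measurable M (count_space UNIV)" for i
    using chain by (simp add: markov_chain_def)
  define past where "past \<omega> \<longleftrightarrow> (\<forall>i\<le>k. X i \<omega> = s i)" for \<omega>
  have [measurable]: "Measurable.pred M past"
    unfolding past_def by measurable
  have extend: "(\<forall>i\<le>Suc k. X i \<omega> = (s(Suc k := j)) i) \<longleftrightarrow> past \<omega> \<and> X (Suc k) \<omega> = j"
    for j \<omega>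
    by (auto simp: past_def le_Suc_eq)
  have step: "\<P>(\<omega> in M. past \<omega> \<and> X (Suc k) \<omega> = j) = \<P>(\<omega> in M. past \<omega>) * P (s k) j" for j
  proof (cases "\<P>(\<omega> in M. past \<omega>) = 0")
    case True
    have "\<P>(\<omega> in M. past \<omega> \<and> X (Suc k) \<omega> = j) \<le> \<P>(\<omega> in M. past \<omega>)"
      by (intro finite_measure_mono) auto
    with True show ?thesis
      by (simp add: measure_le_0_iff)
  next
    case False
    then have "\<P>(\<omega> in M. past \<omega>) > 0"
      by (simp add: zero_less_measure_iff)
    then have "\<P>(\<omega> in M. X (Suc k) \<omega> = j \<bar> past \<omega>) = P (s k) j"
      using chain unfolding markov_chain_def past_def by blast
    with False show ?thesis
      by (simp add: cond_prob_def conj_commute field_simps)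
  qed
  have "(\<lambda>j. \<P>(\<omega> in M. (past \<omega> \<and> X (k + Suc r) \<omega> = m) \<and> X (Suc k) \<omega> = j))
          sums \<P>(\<omega> in M. past \<omega> \<and> X (k + Suc r) \<omega> = m)"
    by (rule prob_sums_over_values) measurable
  moreover have "\<P>(\<omega> in M. (past \<omega> \<and> X (k + Suc r) \<omega> = m) \<and> X (Suc k) \<omega> = j)
      = \<P>(\<omega> in M. past \<omega>) * (P (s k) j * inf_power P r j m)" for j
    using Suc.IH[of "Suc k" "s(Suc k := j)"] step[of j]
    unfolding extend by (simp add: conj_ac mult.assoc)
  ultimately have sums: "(\<lambda>j. \<P>(\<omega> in M. past \<omega>) * (P (s k) j * inf_power P r j m))
      sums \<P>(\<omega> in M. past \<omega> \<and> X (k + Suc r) \<omega> = m)"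
    by simp
  have "\<P>(\<omega> in M. past \<omega> \<and> X (k + Suc r) \<omega> = m)
      = \<P>(\<omega> in M. past \<omega>) * inf_power P (Suc r) (s k) m"
  proof (cases "\<P>(\<omega> in M. past \<omega>) = 0")
    case True
    with sums show ?thesis by (simp add: sums_iff)
  next
    case False
    \<comment> \<open>A nonzero factor transfers summability to the infinite matrix product.\<close>
    with sums have "summable (\<lambda>j. P (s k) j * inf_power P r j m)"
      using summable_mult_D[OF sums_summable[OF sums]] by simp
    with sums show ?thesis
      by (simp add: sums_iff suminf_mult inf_mult_def)
  qed
  then show ?case
    by (simp add: past_def)
qed

text \<open>
  The factor \<open>inf_power P r n m\<close> depends on the past only through the state at time \<open>k\<close>. Hence the
  remaining coordinates can be summed out, from time \<open>k - 1\<close> down to time 0: \<open>l\<close> is the number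
  of coordinates that are still prescribed.
\<close>

lemma prob_given_partial_past_eq_inf_power:
  assumes chain: "markov_chain M X P" and "l \<le> k"
  shows "\<P>(\<omega> in M. (X k \<omega> = n \<and> (\<forall>i<l. X i \<omega> = s i)) \<and> X (k + r) \<omega> = m)
           = \<P>(\<omega> in M. X k \<omega> = n \<and> (\<forall>i<l. X i \<omega> = s i)) * inf_power P r n m"
  using \<open>l \<le> k\<close>
proof (induction arbitrary: s rule: inc_induct)
  case base
  have "(\<forall>i\<le>k. X i \<omega> = (s(k := n)) i) \<longleftrightarrow> X k \<omega> = n \<and> (\<forall>i<k. X i \<omega> = s i)" for \<omega>
    by (auto simp: le_less)
  with prob_given_past_eq_inf_power[OF chain, of k "s(k := n)" r m] show ?case
    by simp
next
  interpret prob_space M using chain by (simp add: markov_chain_def)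
  case (step l)
  have [measurable]: "X i \<in> measurable M (count_space UNIV)" for i
    using chain by (simp add: markov_chain_def)
  define past where "past \<omega> \<longleftrightarrow> X k \<omega> = n \<and> (\<forall>i<l. X i \<omega> = s i)" for \<omega>
  have [measurable]: "Measurable.pred M past"
    unfolding past_def by measurable
  have extend: "X k \<omega> = n \<and> (\<forall>i<Suc l. X i \<omega> = (s(l := j)) i) \<longleftrightarrow> past \<omega> \<and> X l \<omega> = j"
    for j \<omega>
    by (auto simp: past_def less_Suc_eq)
  have "(\<lambda>j. \<P>(\<omega> in M. (past \<omega> \<and> X (k + r) \<omega> = m) \<and> X l \<omega> = j))
          sums \<P>(\<omega> in M. past \<omega> \<and> X (k + r) \<omega> = m)"
    by (rule prob_sums_over_values) measurable
  moreover have "\<P>(\<omega> in M. (past \<omega> \<and> X (k + r) \<omega> = m) \<and> X l \<omega> = j)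
      = \<P>(\<omega> in M. past \<omega> \<and> X l \<omega> = j) * inf_power P r n m" for j
    using step.IH[of "s(l := j)"] unfolding extend by (simp add: conj_ac)
  moreover have "(\<lambda>j. \<P>(\<omega> in M. past \<omega> \<and> X l \<omega> = j) * inf_power P r n m)
          sums (\<P>(\<omega> in M. past \<omega>) * inf_power P r n m)"
    by (intro sums_mult2 prob_sums_over_values) measurable
  ultimately show ?case
    unfolding past_def[symmetric] by (simp add: sums_iff)
qed

theorem transition_probability_eq_inf_power:
  assumes chain: "markov_chain M X P" and pos: "\<P>(\<omega> in M. X k \<omega> = n) > 0"
  shows "transition_probability M X k r n m = inf_power P r n m"
  using prob_given_partial_past_eq_inf_power[OF chain, of 0 k n _ r m] pos
  by (simp add: transition_probability_def cond_prob_def conj_commute)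

section \<open>The Karlin--McGregor representation\<close>

theorem theorem4p1:
  fixes \<mu> :: "real measure" and \<Delta> :: "real set" and w1 w2 :: "real \<Rightarrow> real"
    and B :: "nat \<Rightarrow> real poly" and Q :: "nat \<Rightarrow> real \<Rightarrow> real" and H :: inf_mat
    and n m r :: nat
  assumes AT: "AT_system \<mu> \<Delta> w1 w2"
    and moments: "finite_moments \<mu> \<Delta> w1 w2"
    and minors: "\<And>i. leading_principal_minor (moment_matrix \<mu> \<Delta> w1 w2) i \<noteq> 0"
    and B: "type_II_polys \<mu> \<Delta> w1 w2 B"
    and Q: "type_I_forms \<mu> \<Delta> w1 w2 B Q"
    and H: "hessenberg_matrix B H"
    and bounded: "l2_bounded H"
    and nonneg: "\<And>i j. H i j \<ge> 0"
    and a_pos: "\<And>i. i \<ge> 2 \<Longrightarrow> H i (i - 2) > 0"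
    and norm_one: "norm_one_normalized H"
    and B_pos: "\<And>i. poly (B i) 1 > 0"
    and Q_pos: "\<And>i. Q i 1 > 0"
  shows
    "(inf_power (H_hat B H) r n m
        = poly (B m) 1 / poly (B n) 1 * (LINT x:\<Delta>|\<mu>. x ^ r * poly (B n) x * Q m x) \<and>
      (\<forall>(M :: 'a measure) X k.
         markov_chain M X (H_hat B H) \<and> \<P>(\<omega> in M. X k \<omega> = n) > 0 \<longrightarrow>
         transition_probability M X k r n m = inf_power (H_hat B H) r n m)) \<and>
     (inf_power (H_check Q H) r n m
        = Q m 1 / Q n 1 * (LINT x:\<Delta>|\<mu>. x ^ r * poly (B m) x * Q n x) \<and>
      (\<forall>(M :: 'a measure) X k.
         markov_chain M X (H_check Q H) \<and> \<P>(\<omega> in M. X k \<omega> = n) > 0 \<longrightarrow>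
         transition_probability M X k r n m = inf_power (H_check Q H) r n m))"
proof -
  let ?J = "moment_form \<mu> \<Delta> B Q"
  have hat: "inf_power (H_hat B H) r n m
      = poly (B m) 1 / poly (B n) 1 * (LINT x:\<Delta>|\<mu>. x ^ r * poly (B n) x * Q m x)"
  proof -
    have "inf_power (H_hat B H) r n m = sigma_II B m / sigma_II B n * ?J r n m"
      unfolding H_hat_def
    proof (rule inf_power_diag_conjugate)
      show "sigma_II B i \<noteq> 0" for i
        using B_pos[of i] by (simp add: sigma_II_def)
      show "H i k = 0" if "k > i + 1" for i k
        using H that unfolding hessenberg_matrix_def by (meson not_less)
      show "?J 0 i j = (if i = j then 1 else 0)" for i j
        by (rule moment_form_0[OF Q])
      show "?J (Suc r) i j = (\<Sum>k\<le>i + 1. H i k * ?J r k j)" for r i j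
        by (rule moment_form_Suc_left[OF moments Q H])
    qed
    then show ?thesis
      by (simp add: sigma_II_def moment_form_def)
  qed
  have check: "inf_power (H_check Q H) r n m
      = Q m 1 / Q n 1 * (LINT x:\<Delta>|\<mu>. x ^ r * poly (B m) x * Q n x)"
  proof -
    have "inf_power (H_check Q H) r n m = sigma_I Q m / sigma_I Q n * ?J r m n"
      unfolding H_check_def
    proof (rule inf_power_diag_conjugate[where J = "\<lambda>r i j. ?J r j i"])
      show "sigma_I Q i \<noteq> 0" for i
        using Q_pos[of i] by (simp add: sigma_I_def)
      show "inf_transpose H i k = 0" if "k > i + 2" for i k
        using H that unfolding hessenberg_matrix_def inf_transpose_def by (meson not_less)
      show "?J 0 j i = (if i = j then 1 else 0)" for i j
        by (simp add: moment_form_0[OF Q])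
      show "?J (Suc r) j i = (\<Sum>k\<le>i + 2. inf_transpose H i k * ?J r j k)" for r i j
        unfolding moment_form_Suc_right[OF moments Q H] inf_transpose_def
        by (simp only: mult.commute)
    qed
    then show ?thesis
      by (simp add: sigma_I_def moment_form_def)
  qed
  show ?thesis
    by (intro conjI hat check allI impI transition_probability_eq_inf_power) auto
qed

end
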